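(* Let $(A_n)_{n\ge1}$ be a sequence of $d\times d$ matrices over $\mathbb C$, and suppose that the product-matrix $P_n=A_1\cdots A_n$ is nonnull for every $n$. If the sequence $\frac{A_n}{\Vert A_n\Vert}$ diverges and its limit-points do not have a common left-eigenvector, then the sequence $\frac{P_n}{\Vert P_n\Vert}$ diverges.
   Context: $\Vert X\Vert$ denotes the sum of the absolute values (moduli) of the entries of the matrix $X$. "Diverges" means "does not converge". A limit-point of a sequence is the limit of one of its subsequences. A left-eigenvector of a matrix $A$ is a row-vector $r\ne0$ such that $rA=\lambda r$ for some $\lambda\in\mathbb C$; a common left-eigenvector of a family of matrices is a row-vector $r\ne 0$ which is a left-eigenvector of each of them (possibly for different eigenvalues). *)

theory Defs
  imports "HOL-Analysis.Analysis"
begin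

text \<open>The entrywise \<open>\<ell>\<^sup>1\<close> norm. The library's \<^const>\<open>norm\<close> on
  \<^typ>\<open>complex^'d^'d\<close> is the Frobenius norm, hence the separate definition.\<close>

definition entry_norm :: "complex^'n^'m \<Rightarrow> real" where
  "entry_norm X = (\<Sum>i\<in>UNIV. \<Sum>j\<in>UNIV. cmod (X $ i $ j))"

definition normalized :: "complex^'n^'m \<Rightarrow> complex^'n^'m" where
  "normalized X = X /\<^sub>R entry_norm X"

text \<open>\<open>prod_mat A n = A 1 ** \<dots> ** A n\<close>. Sequences are indexed from 1, so \<open>A 0\<close> is not a factor.\<close>

primrec prod_mat :: "(nat \<Rightarrow> complex^'d^'d) \<Rightarrow> nat \<Rightarrow> complex^'d^'d" where
  "prod_mat A 0 = mat 1"
| "prod_mat A (Suc n) = prod_mat A n ** A (Suc n)"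

text \<open>Limit-points of a sequence are subsequential limits; unlike for \<open>islimpt\<close>, a value taken
  infinitely often counts. The term with index 0 does not affect the set of limit-points.\<close>

definition limit_points :: "(nat \<Rightarrow> 'a::topological_space) \<Rightarrow> 'a set" where
  "limit_points X = {L. \<exists>r. strict_mono r \<and> (X \<circ> r) \<longlonglongrightarrow> L}"

definition left_eigenvector :: "complex^'d \<Rightarrow> complex^'d^'d \<Rightarrow> bool" where
  "left_eigenvector r A \<longleftrightarrow> r \<noteq> 0 \<and> (\<exists>c::complex. r v* A = c *s r)"

text \<open>The eigenvalue may depend on the matrix \<open>A \<in> F\<close>.\<close>

definition common_left_eigenvector :: "complex^'d \<Rightarrow> (complex^'d^'d) set \<Rightarrow> bool" where
  "common_left_eigenvector r F \<longleftrightarrow> r \<noteq> 0 \<and> (\<forall>A\<in>F. left_eigenvector r A)"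

end

theory Submission
  imports Defs
begin

text \<open>If \<open>P\<^sub>n / \<parallel>P\<^sub>n\<parallel>\<close> converged to \<open>Q\<close>, then passing to the limit in
  \<open>(P\<^sub>n / \<parallel>P\<^sub>n\<parallel>) (A\<^sub>n\<^sub>+\<^sub>1 / \<parallel>A\<^sub>n\<^sub>+\<^sub>1\<parallel>) = c\<^sub>n P\<^sub>n\<^sub>+\<^sub>1 / \<parallel>P\<^sub>n\<^sub>+\<^sub>1\<parallel>\<close>
  along a subsequence shows that every limit-point \<open>L\<close> of \<open>A\<^sub>n / \<parallel>A\<^sub>n\<parallel>\<close> satisfies
  \<open>Q L = c Q\<close> for some scalar \<open>c\<close>. Hence any nonzero row of \<open>Q\<close>, which does not depend on \<open>L\<close>,
  is a common left-eigenvector.\<close>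

lemma entry_norm_nonneg: "0 \<le> entry_norm X"
  unfolding entry_norm_def by (intro sum_nonneg) simp

lemma entry_norm_eq_0_iff [simp]: "entry_norm X = 0 \<longleftrightarrow> X = 0"
  by (simp add: entry_norm_def sum_nonneg_eq_0_iff sum_nonneg vec_eq_iff)

lemma entry_norm_scaleR: "entry_norm (c *\<^sub>R X) = \<bar>c\<bar> * entry_norm X"
  by (simp add: entry_norm_def sum_distrib_left)

lemma tendsto_entry_norm:
  assumes "(f \<longlongrightarrow> X) F"
  shows "((\<lambda>x. entry_norm (f x)) \<longlongrightarrow> entry_norm X) F"
  unfolding entry_norm_def by (intro tendsto_intros assms)

lemma tendsto_matrix_mult:
  fixes f :: "'a \<Rightarrow> complex^'m^'n" and g :: "'a \<Rightarrow> complex^'k^'m"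
  assumes "(f \<longlongrightarrow> X) F" and "(g \<longlongrightarrow> Y) F"
  shows "((\<lambda>x. f x ** g x) \<longlongrightarrow> X ** Y) F"
  unfolding matrix_matrix_mult_def by (intro tendsto_intros assms)

lemma entry_norm_normalized: "X \<noteq> 0 \<Longrightarrow> entry_norm (normalized X) = 1"
  by (simp add: normalized_def entry_norm_scaleR entry_norm_nonneg)

lemma scaleR_matrix_mult_scaleR:
  fixes X :: "complex^'m^'n" and Y :: "complex^'k^'m"
  shows "(a *\<^sub>R X) ** (b *\<^sub>R Y) = (a * b) *\<^sub>R (X ** Y)"
  by (simp add: vec_eq_iff matrix_matrix_mult_def scaleR_sum_right mult.commute)

text \<open>Both sides are nonnegative multiples of \<open>X ** Y\<close>. Writing the scalar as the
  norm of the left side, not as a quotient of norms, makes it continuous in the two normalized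
  factors, so it has a limit whenever they do.\<close>

lemma normalized_mult_normalized:
  fixes X :: "complex^'m^'n" and Y :: "complex^'k^'m"
  assumes "X ** Y \<noteq> 0"
  shows "normalized X ** normalized Y
    = entry_norm (normalized X ** normalized Y) *\<^sub>R normalized (X ** Y)"
proof -
  define t where "t = entry_norm (X ** Y) / (entry_norm X * entry_norm Y)"
  have "t \<ge> 0"
    by (simp add: t_def entry_norm_nonneg)
  have "entry_norm (X ** Y) \<noteq> 0"
    using assms by simp
  then have eq: "normalized X ** normalized Y = t *\<^sub>R normalized (X ** Y)"
    unfolding normalized_def t_def scaleR_matrix_mult_scaleR by (simp add: field_simps)
  \<comment> \<open>\<open>normalized (X ** Y)\<close> has norm 1, so taking norms in
    \<open>eq\<close> identifies \<open>t\<close>.\<close>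
  have "entry_norm (t *\<^sub>R normalized (X ** Y)) = t"
    using assms \<open>t \<ge> 0\<close> by (simp add: entry_norm_scaleR entry_norm_normalized)
  with eq show ?thesis
    by simp
qed

lemma row_matrix_mult:
  fixes X :: "complex^'m^'n" and Y :: "complex^'k^'m"
  shows "(X ** Y) $ i = X $ i v* Y"
  by (simp add: vec_eq_iff matrix_matrix_mult_def vector_matrix_mult_def mult.commute)

lemma limit_prod_mult_limit_point:
  fixes A :: "nat \<Rightarrow> complex^'d^'d"
  assumes nz: "\<And>n. n \<ge> 1 \<Longrightarrow> prod_mat A n \<noteq> 0"
    and Q: "(\<lambda>n. normalized (prod_mat A n)) \<longlonglongrightarrow> Q"
    and L: "L \<in> limit_points (\<lambda>n. normalized (A n))"
  shows "Q ** L = entry_norm (Q ** L) *\<^sub>R Q"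
proof -
  define N where "N = (\<lambda>n. normalized (prod_mat A n))"
  define B where "B = (\<lambda>n. normalized (A n))"
  obtain r where r: "strict_mono r" and BL: "(B \<circ> r) \<longlonglongrightarrow> L"
    using L by (auto simp: limit_points_def B_def)
  \<comment> \<open>Shifting by one step gives \<open>r (Suc k) \<ge> 1\<close>, so the junk index 0 never occurs.\<close>
  define s where "s k = r (Suc k) - 1" for k
  have s: "Suc (s k) = r (Suc k)" for k
    using seq_suble[OF r, of "Suc k"] by (simp add: s_def)
  have "strict_mono s"
    using strict_monoD[OF r] s by (metis Suc_less_eq strict_monoI)
  have N: "N \<longlonglongrightarrow> Q"
    using Q by (simp add: N_def)
  have Ns: "(\<lambda>k. N (s k)) \<longlonglongrightarrow> Q"
    using LIMSEQ_subseq_LIMSEQ[OF N \<open>strict_mono s\<close>] by (simp add: o_def)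
  have NSs: "(\<lambda>k. N (Suc (s k))) \<longlonglongrightarrow> Q"
    using LIMSEQ_subseq_LIMSEQ[OF LIMSEQ_Suc[OF N] \<open>strict_mono s\<close>] by (simp add: o_def)
  have Bs: "(\<lambda>k. B (Suc (s k))) \<longlonglongrightarrow> L"
    using LIMSEQ_Suc[OF BL] by (simp add: o_def s)
  have prod: "(\<lambda>k. N (s k) ** B (Suc (s k))) \<longlonglongrightarrow> Q ** L"
    by (intro tendsto_matrix_mult Ns Bs)
  \<comment> \<open>Nonnullness enters only at index \<open>Suc n\<close>, so \<open>n = 0\<close>
    is covered too; \<open>s 0\<close> may be 0.\<close>
  have step: "N n ** B (Suc n) = entry_norm (N n ** B (Suc n)) *\<^sub>R N (Suc n)" for n
    using normalized_mult_normalized[of "prod_mat A n" "A (Suc n)"] nz[of "Suc n"]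
    by (simp add: N_def B_def)
  \<comment> \<open>After rewriting by \<open>step\<close>, the scalar is the norm of a product that
    converges by \<open>prod\<close>.\<close>
  have "(\<lambda>k. N (s k) ** B (Suc (s k))) \<longlonglongrightarrow> entry_norm (Q ** L) *\<^sub>R Q"
    by (subst step) (intro tendsto_scaleR tendsto_entry_norm prod NSs)
  with prod show ?thesis
    by (rule LIMSEQ_unique)
qed

theorem theorem5p1:
  fixes A :: "nat \<Rightarrow> complex^'d^'d"
  assumes "\<And>n. n \<ge> 1 \<Longrightarrow> prod_mat A n \<noteq> 0"
    and "\<not> convergent (\<lambda>n. normalized (A n))"
    and "\<not> (\<exists>r. common_left_eigenvector r (limit_points (\<lambda>n. normalized (A n))))"
  shows "\<not> convergent (\<lambda>n. normalized (prod_mat A n))"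
proof
  assume "convergent (\<lambda>n. normalized (prod_mat A n))"
  then obtain Q where Q: "(\<lambda>n. normalized (prod_mat A n)) \<longlonglongrightarrow> Q"
    by (auto simp: convergent_def)
  \<comment> \<open>Norm 1 passes to the limit, which gives \<open>Q\<close> a nonzero row.\<close>
  have "\<forall>\<^sub>F n in sequentially. entry_norm (normalized (prod_mat A n)) = 1"
    using eventually_ge_at_top[of 1] by eventually_elim (rule entry_norm_normalized[OF assms(1)])
  then have "(\<lambda>n. entry_norm (normalized (prod_mat A n))) \<longlonglongrightarrow> 1"
    by (rule tendsto_eventually)
  then have "entry_norm Q = 1"
    using LIMSEQ_unique[OF tendsto_entry_norm[OF Q]] by simp
  then have "Q \<noteq> 0"
    using entry_norm_eq_0_iff[of Q] by auto
  then obtain i where i: "Q $ i \<noteq> 0"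
    by (auto simp: vec_eq_iff)
  have "left_eigenvector (Q $ i) L" if "L \<in> limit_points (\<lambda>n. normalized (A n))" for L
  proof -
    have "Q $ i v* L = (entry_norm (Q ** L) *\<^sub>R Q) $ i"
      using limit_prod_mult_limit_point[OF assms(1) Q that] row_matrix_mult[of Q L i] by simp
    \<comment> \<open>The eigenvalue is the norm of \<open>Q ** L\<close>, read as a complex number;
      it may vary with \<open>L\<close>, while the row \<open>i\<close> is fixed.\<close>
    also have "\<dots> = complex_of_real (entry_norm (Q ** L)) *s Q $ i"
      by (simp add: vec_eq_iff scaleR_conv_of_real[where 'a = complex])
    finally show ?thesis
      using i by (auto simp: left_eigenvector_def)
  qed
  then have "common_left_eigenvector (Q $ i) (limit_points (\<lambda>n. normalized (A n)))"
    using i by (simp add: common_left_eigenvector_def)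
  with assms(3) show False
    by blast
qed

end
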